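(* Define $m_0=6$, $m_{i+1}=\lfloor m_i^{3/2}\rfloor$ and $\tilde m_i=\lfloor m_i/2\rfloor$ for $i\ge0$, and let $d:\mathbb Z\to\mathbb Z$ be given by $$d(n)=\begin{cases} n & \text{if } |n|=m_i \text{ for some } i\ge0,\\ \mathrm{sign}(n) & \text{if } |n|=1 \text{ or } |n|=\tilde m_i \text{ for some } i\ge0,\\ 0&\text{otherwise.}\end{cases}$$ Then the group $G_d$ satisfies $\mathrm{Cl}_{G_d}(n)\succ n^{4/3}$.
   Context: The sequences $(m_i)$ and $(\tilde m_i)$ have disjoint images. For an anti-symmetric function $d:\mathbb Z\to\mathbb Z$ (i.e. $d(-i)=-d(i)$) with $d(1)=1$, $G_d$ is the group with generators $t$, $a_i$, $c_i$ ($i\in\mathbb Z$) and relations, for all $i,j\in\mathbb Z$: $ta_it^{-1}=a_{i+1}$, $tc_it^{-1}=c_i$, $[a_i,a_j]=c_{i-j}$, $[c_i,a_j]=[c_i,c_j]=1$, $c_i=c_1^{d(i)}$, where $[x,y]=xyx^{-1}y^{-1}$. It is generated by $\{t,a_0\}$. For a group $G$ with finite generating set $S$, word norm $\|\cdot\|_S$ and conjugacy relation $\sim$, the conjugator length function is $$\mathrm{Cl}_{G,S}(n)=\max_{\|g_1\|_S,\|g_2\|_S\le n,\ g_1\sim g_2}\ \min\{\|h\|_S : h\in G,\ hg_1h^{-1}=g_2\}.$$ For functions $f,g$ on the positive integers with non-negative real values, $f\prec g$ (equivalently $g\succ f$) means there is an integer $C\ge1$ with $f(n)\le C\,g(Cn)$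 for all $n\ge1$; $f\simeq g$ means $f\prec g$ and $g\prec f$. Up to $\simeq$, $\mathrm{Cl}_{G,S}$ does not depend on $S$. *)

theory Defs
  imports Complex_Main "HOL-Algebra.Generated_Groups"
begin

section \<open>Groups given by generators and relations\<close>

text \<open>A letter is a generator with a sign; \<open>(x, False)\<close> stands for the formal inverse of \<open>x\<close>.
  A set of relations is a set of pairs of words \<open>(u, v)\<close>, read as \<open>u = v\<close>.\<close>

type_synonym 'g word = "('g \<times> bool) list"

definition gen :: "'g \<Rightarrow> 'g word" where
  "gen x = [(x, True)]"

definition inv_word :: "'g word \<Rightarrow> 'g word" where
  "inv_word w = rev (map (\<lambda>(x, b). (x, \<not> b)) w)"

definition pow_word :: "'g word \<Rightarrow> int \<Rightarrow> 'g word" where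
  "pow_word w k = concat (replicate (nat \<bar>k\<bar>) (if k \<ge> 0 then w else inv_word w))"

definition comm_word :: "'g word \<Rightarrow> 'g word \<Rightarrow> 'g word" where
  "comm_word u v = u @ v @ inv_word u @ inv_word v"

inductive word_eq :: "('g word \<times> 'g word) set \<Rightarrow> 'g word \<Rightarrow> 'g word \<Rightarrow> bool"
  for R where
  rel: "(u, v) \<in> R \<Longrightarrow> word_eq R u v"
| cancel: "word_eq R [(x, b), (x, \<not> b)] []"
| refl: "word_eq R u u"
| sym: "word_eq R u v \<Longrightarrow> word_eq R v u"
| trans: "word_eq R u v \<Longrightarrow> word_eq R v w \<Longrightarrow> word_eq R u w"
| append: "word_eq R u u' \<Longrightarrow> word_eq R v v' \<Longrightarrow> word_eq R (u @ v) (u' @ v')"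

definition word_class :: "('g word \<times> 'g word) set \<Rightarrow> 'g word \<Rightarrow> 'g word set" where
  "word_class R u = {v. word_eq R u v}"

definition presented_group :: "('g word \<times> 'g word) set \<Rightarrow> 'g word set monoid" where
  "presented_group R =
     \<lparr>carrier = range (word_class R),
      mult = (\<lambda>X Y. {w. \<exists>u \<in> X. \<exists>v \<in> Y. word_eq R (u @ v) w}),
      one = word_class R []\<rparr>"

lemma word_class_eq_iff: "word_class R u = word_class R v \<longleftrightarrow> word_eq R u v"
  unfolding word_class_def by (auto intro: word_eq.intros)

lemma mult_word_class:
  "word_class R u \<otimes>\<^bsub>presented_group R\<^esub> word_class R v = word_class R (u @ v)"
  unfolding presented_group_def word_class_def by (auto intro: word_eq.intros)

lemma word_eq_inv_left: "word_eq R (inv_word w @ w) []"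
proof (induction w)
  case Nil
  show ?case by (simp add: inv_word_def word_eq.refl)
next
  case (Cons l w)
  obtain x b where l: "l = (x, b)" by (cases l)
  have c: "word_eq R [(x, \<not> b), (x, b)] []"
    using word_eq.cancel[of R x "\<not> b"] by simp
  have "word_eq R (inv_word w @ [(x, \<not> b), (x, b)] @ w) (inv_word w @ [] @ w)"
    by (intro word_eq.append c word_eq.refl)
  then show ?case
    using Cons.IH by (auto simp: l inv_word_def intro: word_eq.trans)
qed

lemma group_presented_group: "group (presented_group R)"
proof (rule groupI)
  fix X assume "X \<in> carrier (presented_group R)"
  then obtain u where u: "X = word_class R u" by (auto simp: presented_group_def)
  have "word_class R (inv_word u) \<otimes>\<^bsub>presented_group R\<^esub> X = \<one>\<^bsub>presented_group R\<^esub>"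
    unfolding u mult_word_class by (simp add: presented_group_def word_class_eq_iff word_eq_inv_left)
  then show "\<exists>Y \<in> carrier (presented_group R). Y \<otimes>\<^bsub>presented_group R\<^esub> X = \<one>\<^bsub>presented_group R\<^esub>"
    by (auto simp: presented_group_def)
next
  have car: "carrier (presented_group R) = range (word_class R)"
    and one: "\<one>\<^bsub>presented_group R\<^esub> = word_class R []"
    by (simp_all add: presented_group_def)
  show "\<one>\<^bsub>presented_group R\<^esub> \<in> carrier (presented_group R)"
    by (simp add: car one)
  show "X \<otimes>\<^bsub>presented_group R\<^esub> Y \<in> carrier (presented_group R)"
    if "X \<in> carrier (presented_group R)" "Y \<in> carrier (presented_group R)" for X Y
    using that by (auto simp: car mult_word_class)
  show "X \<otimes>\<^bsub>presented_group R\<^esub> Y \<otimes>\<^bsub>presented_group R\<^esub> Z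
      = X \<otimes>\<^bsub>presented_group R\<^esub> (Y \<otimes>\<^bsub>presented_group R\<^esub> Z)"
    if "X \<in> carrier (presented_group R)" "Y \<in> carrier (presented_group R)"
      "Z \<in> carrier (presented_group R)" for X Y Z
    using that by (auto simp: car mult_word_class)
  show "\<one>\<^bsub>presented_group R\<^esub> \<otimes>\<^bsub>presented_group R\<^esub> X = X"
    if "X \<in> carrier (presented_group R)" for X
    using that by (auto simp: car one mult_word_class)
qed

lemma inv_word_class:
  "inv\<^bsub>presented_group R\<^esub> (word_class R u) = word_class R (inv_word u)"
proof -
  interpret group "presented_group R" by (rule group_presented_group)
  have "word_class R (inv_word u) \<otimes>\<^bsub>presented_group R\<^esub> word_class R u = \<one>\<^bsub>presented_group R\<^esub>"
    unfolding mult_word_class by (simp add: presented_group_def word_class_eq_iff word_eq_inv_left)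
  then show ?thesis
    by (rule inv_equality) (simp_all add: presented_group_def)
qed

section \<open>Word norm and conjugator length\<close>

definition finite_generating_set :: "('a, 'b) monoid_scheme \<Rightarrow> 'a set \<Rightarrow> bool" where
  "finite_generating_set G S \<longleftrightarrow> finite S \<and> S \<subseteq> carrier G \<and> generate G S = carrier G"

definition word_norm :: "('a, 'b) monoid_scheme \<Rightarrow> 'a set \<Rightarrow> 'a \<Rightarrow> nat" where
  "word_norm G S g =
     (LEAST k. \<exists>xs. set xs \<subseteq> S \<union> m_inv G ` S \<and> length xs = k \<and> foldr (mult G) xs (one G) = g)"

definition conjugators :: "('a, 'b) monoid_scheme \<Rightarrow> 'a \<Rightarrow> 'a \<Rightarrow> 'a set" where
  "conjugators G g1 g2 = {h \<in> carrier G. h \<otimes>\<^bsub>G\<^esub> g1 \<otimes>\<^bsub>G\<^esub> inv\<^bsub>G\<^esub> h = g2}"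

definition conjugate :: "('a, 'b) monoid_scheme \<Rightarrow> 'a \<Rightarrow> 'a \<Rightarrow> bool" where
  "conjugate G g1 g2 \<longleftrightarrow> conjugators G g1 g2 \<noteq> {}"

definition conjugator_norm :: "('a, 'b) monoid_scheme \<Rightarrow> 'a set \<Rightarrow> 'a \<Rightarrow> 'a \<Rightarrow> nat" where
  "conjugator_norm G S g1 g2 = (LEAST k. \<exists>h \<in> conjugators G g1 g2. word_norm G S h = k)"

text \<open>For a finite generating set \<open>S\<close> the set below is finite and nonempty, so \<open>Max\<close> is the
  maximum.\<close>

definition conjugator_length :: "('a, 'b) monoid_scheme \<Rightarrow> 'a set \<Rightarrow> nat \<Rightarrow> nat" where
  "conjugator_length G S n =
     Max {conjugator_norm G S g1 g2 | g1 g2.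
            g1 \<in> carrier G \<and> g2 \<in> carrier G \<and>
            word_norm G S g1 \<le> n \<and> word_norm G S g2 \<le> n \<and> conjugate G g1 g2}"

text \<open>\<open>f \<prec> g\<close> for functions on the positive integers; values at \<open>0\<close> are irrelevant.\<close>

definition dominated :: "(nat \<Rightarrow> real) \<Rightarrow> (nat \<Rightarrow> real) \<Rightarrow> bool" where
  "dominated f g \<longleftrightarrow> (\<exists>C::nat. C \<ge> 1 \<and> (\<forall>n \<ge> 1. f n \<le> real C * g (C * n)))"

section \<open>The groups \<open>G\<^sub>d\<close>\<close>

datatype gen_G = Gen_t | Gen_a int | Gen_c int

abbreviation "t_w \<equiv> gen Gen_t"
abbreviation "a_w i \<equiv> gen (Gen_a i)"
abbreviation "c_w i \<equiv> gen (Gen_c i)"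

inductive_set rels_G :: "(int \<Rightarrow> int) \<Rightarrow> (gen_G word \<times> gen_G word) set"
  for d where
  "(t_w @ a_w i @ inv_word t_w, a_w (i + 1)) \<in> rels_G d"
| "(t_w @ c_w i @ inv_word t_w, c_w i) \<in> rels_G d"
| "(comm_word (a_w i) (a_w j), c_w (i - j)) \<in> rels_G d"
| "(comm_word (c_w i) (a_w j), []) \<in> rels_G d"
| "(comm_word (c_w i) (c_w j), []) \<in> rels_G d"
| "(c_w i, pow_word (c_w 1) (d i)) \<in> rels_G d"

definition group_G :: "(int \<Rightarrow> int) \<Rightarrow> gen_G word set monoid" where
  "group_G d = presented_group (rels_G d)"

lemma finite_generating_set_group_G:
  "finite_generating_set (group_G d)
     {word_class (rels_G d) t_w, word_class (rels_G d) (a_w 0)}"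
proof -
  let ?R = "rels_G d"
  let ?G = "presented_group ?R"
  let ?S = "{word_class ?R t_w, word_class ?R (a_w 0)}"
  let ?H = "{w. word_class ?R w \<in> generate ?G ?S}"
  interpret group ?G by (rule group_presented_group)
  have S: "?S \<subseteq> carrier ?G" by (auto simp: presented_group_def)
  have app: "u @ v \<in> ?H" if "u \<in> ?H" "v \<in> ?H" for u v
    using generate.eng[of "word_class ?R u" ?G ?S "word_class ?R v"] that
    by (simp add: mult_word_class)
  have inv: "inv_word u \<in> ?H" if "u \<in> ?H" for u
    using generate_m_inv_closed[OF S, of "word_class ?R u"] that by (simp add: inv_word_class)
  have eq: "v \<in> ?H" if "u \<in> ?H" "word_eq ?R u v" for u v
    using that word_class_eq_iff[of ?R u v] by simp
  have t: "t_w \<in> ?H" and a0: "a_w 0 \<in> ?H" by (auto intro: generate.incl)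
  have a: "a_w i \<in> ?H" for i
  proof (induction i rule: int_induct[of _ 0])
    case base
    show ?case by (rule a0)
  next
    case (step1 i)
    then show ?case
      using eq[OF app[OF t app[OF step1(2) inv[OF t]]] word_eq.rel[OF rels_G.intros(1)[of i d]]]
      by simp
  next
    case (step2 i)
    have r: "word_eq ?R (t_w @ a_w (i - 1) @ inv_word t_w) (a_w i)"
      using word_eq.rel[OF rels_G.intros(1)[of "i - 1" d]] by simp
    have c: "word_eq ?R (inv_word t_w @ t_w) []" by (rule word_eq_inv_left)
    have 1: "word_eq ?R (inv_word t_w @ (t_w @ a_w (i - 1) @ inv_word t_w) @ t_w)
        (inv_word t_w @ a_w i @ t_w)"
      by (intro word_eq.append r word_eq.refl)
    have 2: "word_eq ?R ((inv_word t_w @ t_w) @ a_w (i - 1) @ (inv_word t_w @ t_w))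
        ([] @ a_w (i - 1) @ [])"
      by (intro word_eq.append c word_eq.refl)
    have "word_eq ?R (inv_word t_w @ a_w i @ t_w) (a_w (i - 1))"
      using word_eq.trans[OF word_eq.sym[OF 1]] 2 by simp
    then show ?case
      using eq[OF app[OF inv[OF t] app[OF step2(2) t]]] by simp
  qed
  have c: "c_w i \<in> ?H" for i
  proof -
    have "comm_word (a_w i) (a_w 0) \<in> ?H"
      unfolding comm_word_def by (rule app[OF a app[OF a app[OF inv[OF a] inv[OF a]]]])
    then show ?thesis
      using eq[OF _ word_eq.rel[OF rels_G.intros(3)[of i 0 d]]] by simp
  qed
  have g: "gen x \<in> ?H" for x
    using t a c by (cases x) blast+
  have l: "[(x, b)] \<in> ?H" for x b
    using g[of x] inv[OF g[of x]] by (cases b) (simp_all add: gen_def inv_word_def)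
  have "w \<in> ?H" for w
  proof (induction w)
    case Nil
    show ?case using generate.one[of ?G ?S] by (simp add: presented_group_def)
  next
    case (Cons y w)
    then show ?case using app[OF l[of "fst y" "snd y"] Cons] by simp
  qed
  then have "carrier ?G \<subseteq> generate ?G ?S" by (auto simp: presented_group_def)
  then show ?thesis
    using generate_incl[OF S] S by (auto simp: finite_generating_set_def group_G_def)
qed

section \<open>The function \<open>d\<close>\<close>

primrec m_seq :: "nat \<Rightarrow> nat" where
  "m_seq 0 = 6"
| "m_seq (Suc i) = nat \<lfloor>real (m_seq i) powr (3 / 2)\<rfloor>"

definition m_tilde :: "nat \<Rightarrow> nat" where
  "m_tilde i = m_seq i div 2"

definition d_fun :: "int \<Rightarrow> int" where
  "d_fun n =
     (if \<exists>i. \<bar>n\<bar> = int (m_seq i) then n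
      else if \<bar>n\<bar> = 1 \<or> (\<exists>i. \<bar>n\<bar> = int (m_tilde i)) then sgn n
      else 0)"

lemma m_seq_ge: "m_seq i \<ge> 6"
proof (induction i)
  case (Suc i)
  have "real (m_seq i) powr 1 \<le> real (m_seq i) powr (3 / 2)"
    using Suc by (intro powr_mono) auto
  then have "int (m_seq i) \<le> \<lfloor>real (m_seq i) powr (3 / 2)\<rfloor>"
    using Suc by (simp add: le_floor_iff)
  then show ?case using Suc by simp
qed simp

lemma d_fun_minus: "d_fun (- n) = - d_fun n"
  by (simp add: d_fun_def)

lemma d_fun_1: "d_fun 1 = 1"
proof -
  have "\<bar>1\<bar> \<noteq> int (m_seq i)" for i using m_seq_ge[of i] by linarith
  then show ?thesis by (auto simp: d_fun_def)
qed

end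

theory Submission
  imports Defs
begin

text \<open>
  The witnesses are the conjugate pairs \<open>a\<^sub>0\<close> and \<open>c\<^sub>1\<^sup>z a\<^sub>0\<close>. Write \<open>c = c\<^sub>1\<close>, which is central of
  infinite order. Conjugating \<open>a\<^sub>0\<close> by an element with \<open>t\<close>-exponent \<open>k\<close> gives \<open>a\<^sub>k\<close> times a power
  of \<open>c\<close>, so every conjugator of the pair has \<open>k = 0\<close>; if \<open>y\<^sub>j\<close> is its total exponent in \<open>a\<^sub>j\<close>, then
  \<open>[a\<^sub>j, a\<^sub>0] = c\<^bsup>d(j)\<^esup>\<close> turns the conjugation equation into \<open>\<Sum>\<^sub>j y\<^sub>j d(j) = z\<close>
  (\<open>conjugator_a_sum\<close>). A conjugator of norm \<open>L\<close> has \<open>\<Sum>\<bar>y\<^sub>j\<bar>\<close> and all its positions \<open>\<bar>j\<bar>\<close> bounded by a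
  multiple of \<open>L\<close>, so \<open>z\<close> is at most about \<open>L\<close> times the maximum of \<open>\<bar>d\<bar>\<close> on \<open>[-L, L]\<close>
  (\<open>abs_a_sum_le\<close>).

  Given \<open>n\<close>, choose \<open>m = m\<^sub>i \<le> n < m\<^bsub>i+1\<^esub>\<close> and \<open>z = n\<^sup>2 m\<close>. Both elements are short, because
  \<open>c\<^sup>z = [a\<^sub>m\<^sup>n, a\<^sub>0\<^sup>n]\<close> and \<open>a\<^sub>m\<^sup>n = t\<^sup>m a\<^sub>0\<^sup>n t\<^bsup>-m\<^esup>\<close> have norm \<open>O(m + n) = O(n)\<close>
  (\<open>word_norm_C_pow\<close>). They are conjugate, by \<open>a\<^sub>m\<close> to the power \<open>n\<^sup>2\<close>. A conjugator may save letters
  \<open>a\<^sub>j\<close> only by going out to a position where \<open>d\<close> is larger than \<open>m\<close>, and the sparseness of \<open>(m\<^sub>i)\<close> limits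
  the gain: below \<open>m\<^bsub>i+2\<^esub>\<close> the values of \<open>\<bar>d\<bar>\<close> are at most \<open>m\<^bsub>i+1\<^esub> \<le> m\<^bsup>3/2\<^esup>\<close>, whence
  \<open>L \<ge> n\<^sup>2 m / m\<^bsup>3/2\<^esup> \<ge> n\<^bsup>3/2\<^esup>\<close>; and reaching \<open>m\<^bsub>i+2\<^esub>\<close> costs about \<open>m\<^bsub>i+1\<^esub>\<close> to the power
  \<open>3/2\<close>, again at least \<open>n\<^bsup>3/2\<^esup>\<close>, all up to constants (\<open>weight_lower_bound\<close>). This gives the exponent
  \<open>3/2\<close>, which exceeds \<open>4/3\<close>.

  The equation \<open>\<Sum>\<^sub>j y\<^sub>j d(j) = z\<close> needs \<open>c\<close> to have infinite order, which is not visible from the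
  presentation. It is extracted from an explicit action of the generators that respects
  all the relations.
\<close>

section \<open>Word norms and conjugator length in finitely generated groups\<close>

context group
begin

lemma foldr_mult_closed:
  "set xs \<subseteq> carrier G \<Longrightarrow> foldr (\<otimes>) xs \<one> \<in> carrier G"
  by (induction xs) auto

lemma foldr_mult_append:
  assumes "set xs \<subseteq> carrier G" "set ys \<subseteq> carrier G"
  shows "foldr (\<otimes>) (xs @ ys) \<one> = foldr (\<otimes>) xs \<one> \<otimes> foldr (\<otimes>) ys \<one>"
  using assms by (induction xs) (auto simp: foldr_mult_closed m_assoc)

lemma generate_imp_product:
  assumes S: "S \<subseteq> carrier G" and "g \<in> generate G S"
  shows "\<exists>xs. set xs \<subseteq> S \<union> m_inv G ` S \<and> foldr (\<otimes>) xs \<one> = g"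
  using assms(2)
proof (induction rule: generate.induct)
  case one
  show ?case by (intro exI[of _ "[]"]) simp
next
  case (incl h)
  then show ?case using S by (intro exI[of _ "[h]"]) auto
next
  case (inv h)
  then show ?case using S by (intro exI[of _ "[inv h]"]) auto
next
  case (eng g h)
  then obtain xs ys where xs: "set xs \<subseteq> S \<union> m_inv G ` S" "foldr (\<otimes>) xs \<one> = g"
    and ys: "set ys \<subseteq> S \<union> m_inv G ` S" "foldr (\<otimes>) ys \<one> = h"
    by blast
  moreover have "S \<union> m_inv G ` S \<subseteq> carrier G" using S by auto
  ultimately have "foldr (\<otimes>) (xs @ ys) \<one> = g \<otimes> h"
    by (subst foldr_mult_append) auto
  then show ?case using xs(1) ys(1) by (intro exI[of _ "xs @ ys"]) auto
qed

lemma word_norm_le: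
  assumes "set xs \<subseteq> S \<union> m_inv G ` S"
  shows "word_norm G S (foldr (\<otimes>) xs \<one>) \<le> length xs"
  unfolding word_norm_def by (rule Least_le) (use assms in auto)

lemma word_norm_one: "word_norm G S \<one> = 0"
  using word_norm_le[of "[]" S] by simp

context
  fixes S
  assumes S: "finite_generating_set G S"
begin

lemma symmetrized_subset: "S \<union> m_inv G ` S \<subseteq> carrier G"
  using S by (auto simp: finite_generating_set_def)

lemma obtain_shortest_product:
  assumes "g \<in> carrier G"
  obtains xs where "set xs \<subseteq> S \<union> m_inv G ` S" "length xs = word_norm G S g"
    "foldr (\<otimes>) xs \<one> = g"
proof -
  have "\<exists>k xs. set xs \<subseteq> S \<union> m_inv G ` S \<and> length xs = k \<and> foldr (\<otimes>) xs \<one> = g"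
    using generate_imp_product[of S g] S assms by (auto simp: finite_generating_set_def)
  from LeastI_ex[OF this] show ?thesis
    using that unfolding word_norm_def by auto
qed

lemma word_norm_mult_le:
  assumes "g \<in> carrier G" "h \<in> carrier G"
  shows "word_norm G S (g \<otimes> h) \<le> word_norm G S g + word_norm G S h"
proof -
  obtain xs where xs: "set xs \<subseteq> S \<union> m_inv G ` S" "length xs = word_norm G S g"
    "foldr (\<otimes>) xs \<one> = g"
    using obtain_shortest_product assms(1) by blast
  obtain ys where ys: "set ys \<subseteq> S \<union> m_inv G ` S" "length ys = word_norm G S h"
    "foldr (\<otimes>) ys \<one> = h"
    using obtain_shortest_product assms(2) by blast
  have "foldr (\<otimes>) (xs @ ys) \<one> = g \<otimes> h"
    using foldr_mult_append[of xs ys] xs ys symmetrized_subset by auto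
  then show ?thesis
    using word_norm_le[of "xs @ ys" S] xs ys by auto
qed

lemma word_norm_pow_le:
  assumes "g \<in> carrier G"
  shows "word_norm G S (g [^] (n::nat)) \<le> n * word_norm G S g"
proof (induction n)
  case (Suc n)
  then show ?case
    using word_norm_mult_le[of "g [^] n" g] assms by auto
qed (simp add: word_norm_one)

lemma finite_word_norm_ball: "finite {g \<in> carrier G. word_norm G S g \<le> n}"
proof (rule finite_subset)
  let ?A = "S \<union> m_inv G ` S"
  show "{g \<in> carrier G. word_norm G S g \<le> n}
      \<subseteq> (\<lambda>xs. foldr (\<otimes>) xs \<one>) ` {xs. set xs \<subseteq> ?A \<and> length xs \<le> n}"
    by (auto simp: image_iff) (metis obtain_shortest_product)
  show "finite ((\<lambda>xs. foldr (\<otimes>) xs \<one>) ` {xs. set xs \<subseteq> ?A \<and> length xs \<le> n})"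
    using S by (intro finite_imageI finite_lists_length_le) (auto simp: finite_generating_set_def)
qed

lemma conjugator_norm_le_conjugator_length:
  assumes "g1 \<in> carrier G" "g2 \<in> carrier G" "conjugate G g1 g2"
    and "word_norm G S g1 \<le> n" "word_norm G S g2 \<le> n"
  shows "conjugator_norm G S g1 g2 \<le> conjugator_length G S n"
  unfolding conjugator_length_def
proof (rule Max_ge)
  let ?B = "{g \<in> carrier G. word_norm G S g \<le> n}"
  show "finite {conjugator_norm G S g1 g2 | g1 g2.
            g1 \<in> carrier G \<and> g2 \<in> carrier G \<and>
            word_norm G S g1 \<le> n \<and> word_norm G S g2 \<le> n \<and> conjugate G g1 g2}"
    by (rule finite_subset[of _ "(\<lambda>(g1, g2). conjugator_norm G S g1 g2) ` (?B \<times> ?B)"])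
      (auto intro: finite_word_norm_ball)
qed (use assms in auto)

end

lemma obtain_shortest_conjugator:
  assumes "conjugate G g1 g2"
  obtains h where "h \<in> conjugators G g1 g2" "word_norm G S h = conjugator_norm G S g1 g2"
proof -
  have "\<exists>k. \<exists>h \<in> conjugators G g1 g2. word_norm G S h = k"
    using assms by (auto simp: conjugate_def)
  from LeastI_ex[OF this] show ?thesis
    using that unfolding conjugator_norm_def by auto
qed

text \<open>The next three lemmas are the calculus of class 2 nilpotency: if \<open>z = [x, y]\<close> commutes with \<open>x\<close>
  and \<open>y\<close>, then \<open>[x\<^sup>i, y\<^sup>j] = z\<^bsup>ij\<^esup>\<close>. The product \<open>i j\<close> in the exponent is what makes large powers of
  the central generator short.\<close>

lemma pow_mult_commutator_left:
  assumes [simp]: "x \<in> carrier G" "y \<in> carrier G" "z \<in> carrier G"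
    and xy: "x \<otimes> y = z \<otimes> y \<otimes> x" and zx: "z \<otimes> x = x \<otimes> z"
  shows "x [^] (n::nat) \<otimes> y = z [^] n \<otimes> y \<otimes> x [^] n"
proof (induction n)
  case (Suc n)
  have zn: "x [^] n \<otimes> z = z \<otimes> x [^] n"
    using group_commutes_pow[of x z n] zx by simp
  have "x [^] Suc n \<otimes> y = x [^] n \<otimes> (z \<otimes> y \<otimes> x)"
    by (simp add: m_assoc xy)
  also have "\<dots> = z \<otimes> (x [^] n \<otimes> y) \<otimes> x"
    by (metis assms(1-3) m_assoc m_closed nat_pow_closed zn)
  also have "\<dots> = z \<otimes> z [^] n \<otimes> y \<otimes> x [^] Suc n"
    by (simp add: Suc m_assoc)
  also have "z \<otimes> z [^] n = z [^] Suc n"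
    by (rule nat_pow_Suc2[symmetric]) simp
  finally show ?case .
qed simp

lemma pow_mult_commutator_right:
  assumes [simp]: "x \<in> carrier G" "y \<in> carrier G" "z \<in> carrier G"
    and xy: "x \<otimes> y = z \<otimes> y \<otimes> x" and zy: "z \<otimes> y = y \<otimes> z"
  shows "x \<otimes> y [^] (n::nat) = z [^] n \<otimes> y [^] n \<otimes> x"
proof (induction n)
  case (Suc n)
  have zn: "y [^] n \<otimes> z = z \<otimes> y [^] n"
    using group_commutes_pow[of y z n] zy by simp
  have "x \<otimes> y [^] Suc n = z [^] n \<otimes> y [^] n \<otimes> (x \<otimes> y)"
    by (metis Suc assms(1,2,3) m_assoc m_closed nat_pow_Suc nat_pow_closed)
  also have "\<dots> = z [^] n \<otimes> (y [^] n \<otimes> z) \<otimes> y \<otimes> x"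
    by (simp add: xy m_assoc)
  also have "\<dots> = z [^] Suc n \<otimes> y [^] Suc n \<otimes> x"
    by (simp add: zn m_assoc)
  finally show ?case .
qed simp

lemma pow_mult_pow_commutator:
  assumes [simp]: "x \<in> carrier G" "y \<in> carrier G" "z \<in> carrier G"
    and "x \<otimes> y = z \<otimes> y \<otimes> x" "z \<otimes> x = x \<otimes> z" and zy: "z \<otimes> y = y \<otimes> z"
  shows "x [^] (i::nat) \<otimes> y [^] (j::nat) = z [^] (i * j) \<otimes> y [^] j \<otimes> x [^] i"
proof -
  have "z [^] i \<otimes> y = y \<otimes> z [^] i"
    using group_commutes_pow[of z y i] zy by simp
  then show ?thesis
    using pow_mult_commutator_right[of "x [^] i" y "z [^] i" j]
      pow_mult_commutator_left[of x y z i] assms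
    by (simp add: nat_pow_pow)
qed

end

section \<open>The right regular action of \<open>G\<^sub>d\<close> in coordinates\<close>

text \<open>\<open>G\<^sub>d\<close> is a central extension of \<open>\<int> \<wr> \<int>\<close> by \<open>\<langle>c\<^sub>1\<rangle>\<close> whose commutator form on the base group is
  \<open>\<omega>(e\<^sub>i, e\<^sub>j) = d(i - j)\<close>. The following is the part of \<open>\<omega>\<close> below the diagonal, a cocycle for this
  extension: \<open>half_form d i j - half_form d j i = d (i - j)\<close>. It depends only on \<open>i - j\<close>, so it is
  compatible with the shift by \<open>t\<close>.\<close>

definition half_form :: "(int \<Rightarrow> int) \<Rightarrow> int \<Rightarrow> int \<Rightarrow> int" where
  "half_form d i j = (if j < i then d (i - j) else 0)"

text \<open>An element \<open>(x, z) t\<^sup>k\<close>, with \<open>x\<close> in the base group and central coordinate \<open>z\<close>, is stored as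
  \<open>(k, p, z)\<close> with \<open>p j = \<beta>(x, e\<^sub>j)\<close>, \<open>\<beta>\<close> being the bilinear extension of \<open>half_form\<close>, and letters act by right
  multiplication. Since \<open>(x, z) t\<^sup>k a\<^sub>i = (x + e\<^bsub>i+k\<^esub>, z + \<beta>(x, e\<^bsub>i+k\<^esub>)) t\<^sup>k\<close>, the action only
  reads the value \<open>p (i + k)\<close>. Keeping \<open>p\<close> instead of \<open>x\<close> avoids finite supports: the letters
  act on all triples, and the relations hold as identities between these actions.\<close>

fun act :: "(int \<Rightarrow> int) \<Rightarrow> gen_G \<times> bool \<Rightarrow> int \<times> (int \<Rightarrow> int) \<times> int
    \<Rightarrow> int \<times> (int \<Rightarrow> int) \<times> int" where
  "act d (Gen_t, b) (k, p, z) = (k + (if b then 1 else -1), p, z)"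
| "act d (Gen_a i, b) (k, p, z) =
     (if b then (k, \<lambda>j. p j + half_form d (i + k) j, z + p (i + k))
      else (k, \<lambda>j. p j - half_form d (i + k) j, z - p (i + k)))"
| "act d (Gen_c i, b) (k, p, z) = (k, p, z + (if b then d i else - d i))"

abbreviation run :: "(int \<Rightarrow> int) \<Rightarrow> gen_G word \<Rightarrow> int \<times> (int \<Rightarrow> int) \<times> int
    \<Rightarrow> int \<times> (int \<Rightarrow> int) \<times> int" where
  "run d \<equiv> fold (act d)"

lemma run_c_power:
  "(act d (Gen_c i, True) ^^ n) (k, p, z) = (k, p, z + int n * d i)"
  "(act d (Gen_c i, False) ^^ n) (k, p, z) = (k, p, z - int n * d i)"
  by (induction n) (auto simp: algebra_simps)

lemma concat_replicate_singleton: "concat (replicate n [x]) = replicate n x"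
  by (induction n) auto

lemma run_rels_G:
  assumes anti: "\<And>i. d (- i) = - d i" and d1: "d 1 = 1" and "(u, v) \<in> rels_G d"
  shows "run d u s = run d v s"
proof -
  obtain k p z where s: "s = (k, p, z)" by (cases s)
  have d0: "d 0 = 0" using anti[of 0] by simp
  show ?thesis
    using assms(3)
  proof cases
    case (3 i j)
    have "half_form d (i + k) (j + k) - half_form d (j + k) (i + k) = d (i - j)"
      using anti[of "i - j"] by (cases i j rule: linorder_cases) (auto simp: half_form_def d0)
    then show ?thesis
      unfolding 3 s by (simp add: comm_word_def gen_def inv_word_def half_form_def[of d x x for x])
  next
    case (6 i)
    then show ?thesis
      by (simp add: s pow_word_def gen_def inv_word_def concat_replicate_singleton run_c_power d1)
  qed (auto simp: s comm_word_def gen_def inv_word_def algebra_simps fun_eq_iff half_form_def[of d x x for x])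
qed

lemma run_word_eq:
  assumes anti: "\<And>i. d (- i) = - d i" and d1: "d 1 = 1" and "word_eq (rels_G d) u v"
  shows "run d u s = run d v s"
  using assms(3)
proof (induction arbitrary: s rule: word_eq.induct)
  case (rel u v)
  then show ?case using run_rels_G[OF anti d1] by blast
next
  case (cancel x b)
  show ?case by (cases s; cases x) (auto simp: half_form_def)
qed auto

text \<open>When a prefix of \<open>w\<close> has brought the \<open>t\<close>-coordinate from \<open>k\<close> to \<open>k'\<close>, the next letter \<open>a\<^sub>i\<close>
  contributes \<open>e\<^bsub>i+k'\<^esub>\<close> to the base group. Thus \<open>a_sum w k q\<close> is \<open>\<Sum>\<^sub>j y\<^sub>j q(j)\<close>, where \<open>y\<close> is the total
  contribution of \<open>w\<close>.\<close>

fun a_sum :: "gen_G word \<Rightarrow> int \<Rightarrow> (int \<Rightarrow> int) \<Rightarrow> int" where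
  "a_sum [] k q = 0"
| "a_sum ((Gen_t, b) # w) k q = a_sum w (k + (if b then 1 else -1)) q"
| "a_sum ((Gen_a i, b) # w) k q = (if b then q (i + k) else - q (i + k)) + a_sum w k q"
| "a_sum ((Gen_c i, b) # w) k q = a_sum w k q"

fun t_sum :: "gen_G word \<Rightarrow> int" where
  "t_sum [] = 0"
| "t_sum ((Gen_t, b) # w) = (if b then 1 else -1) + t_sum w"
| "t_sum ((Gen_a i, b) # w) = t_sum w"
| "t_sum ((Gen_c i, b) # w) = t_sum w"

lemma a_sum_diff:
  "a_sum w k q - a_sum w k r = a_sum w k (\<lambda>j. q j - r j)"
  by (induction w k q rule: a_sum.induct) (auto simp: algebra_simps)

text \<open>The action is affine in \<open>(p, z)\<close>: adding \<open>q\<close> to \<open>p\<close> changes the final \<open>z\<close> by the values of \<open>q\<close> read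
  on the way.\<close>

lemma run_translate:
  "run d w (k, \<lambda>j. p j + q j, z + y) =
     (let (k', p', z') = run d w (k, p, z) in (k', \<lambda>j. p' j + q j, z' + y + a_sum w k q))"
proof (induction w k q arbitrary: p z y rule: a_sum.induct)
  case (3 i b w k q)
  let ?e = "if b then 1 else - 1 :: int"
  have "run d ((Gen_a i, b) # w) (k, \<lambda>j. p j + q j, z + y) =
    run d w (k, \<lambda>j. (p j + ?e * half_form d (i + k) j) + q j,
       (z + ?e * p (i + k)) + (y + ?e * q (i + k)))"
    by (auto simp: algebra_simps)
  also have "\<dots> = (let (k', p', z') = run d w (k, \<lambda>j. p j + ?e * half_form d (i + k) j, z + ?e * p (i + k))
    in (k', \<lambda>j. p' j + q j, z' + (y + ?e * q (i + k)) + a_sum w k q))"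
    by (rule 3)
  also have "\<dots> = (let (k', p', z') = run d ((Gen_a i, b) # w) (k, p, z)
    in (k', \<lambda>j. p' j + q j, z' + y + a_sum ((Gen_a i, b) # w) k q))"
    by (auto simp: Let_def split: prod.splits)
  finally show ?case .
next
  case (4 i b w k q)
  have "run d ((Gen_c i, b) # w) (k, \<lambda>j. p j + q j, z + y) =
     run d w (k, \<lambda>j. p j + q j, (z + (if b then d i else - d i)) + y)"
    by (simp add: algebra_simps)
  then show ?case by (simp add: 4)
qed auto

lemma run_components:
  "\<exists>z'. run d w (k, p, z) = (k + t_sum w, \<lambda>l. p l + a_sum w k (\<lambda>i. half_form d i l), z')"
proof (induction w k "\<lambda>_::int. 0::int" arbitrary: p z rule: a_sum.induct)
  case (3 i b w k)
  let ?e = "if b then 1 else - 1 :: int"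
  obtain z' where "run d w (k, \<lambda>j. p j + ?e * half_form d (i + k) j, z + ?e * p (i + k))
      = (k + t_sum w, \<lambda>l. (p l + ?e * half_form d (i + k) l) + a_sum w k (\<lambda>i. half_form d i l), z')"
    using 3 by blast
  then show ?case by (auto simp: algebra_simps)
qed (auto simp: algebra_simps)

text \<open>Both sides of the conjugation equation are run from the trivial state. On the left, the last
  letter \<open>a\<^sub>0\<close> reads \<open>\<beta>(y, e\<^sub>0)\<close>, where \<open>y\<close> is the base group part of \<open>w\<close>; on the right, the earlier
  \<open>a\<^sub>0\<close> is felt by all letters of \<open>w\<close>, which adds \<open>\<beta>(e\<^sub>0, y)\<close>. The difference is
  \<open>\<omega>(y, e\<^sub>0) = \<Sum>\<^sub>j y\<^sub>j d(j)\<close>.\<close>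

lemma conjugator_word_a_sum:
  assumes anti: "\<And>i. d (- i) = - d i" and d1: "d 1 = 1"
    and conj: "word_eq (rels_G d) (w @ a_w 0) (replicate n (Gen_c m, True) @ a_w 0 @ w)"
  shows "a_sum w 0 d = int n * d m"
proof -
  have d0: "d 0 = 0" using anti[of 0] by simp
  obtain z where run: "run d w (0, \<lambda>_. 0, 0)
      = (t_sum w, \<lambda>l. a_sum w 0 (\<lambda>i. half_form d i l), z)" (is "_ = (?k, ?p, z)")
    using run_components[of d w 0 "\<lambda>_. 0" 0] by auto
  have 1: "run d (w @ a_w 0) (0, \<lambda>_. 0, 0) = (?k, \<lambda>j. ?p j + half_form d ?k j, z + ?p ?k)"
    by (simp add: run gen_def)
  have 2: "run d (replicate n (Gen_c m, True) @ a_w 0 @ w) (0, \<lambda>_. 0, 0)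
      = (?k, \<lambda>j. ?p j + half_form d 0 j, z + int n * d m + a_sum w 0 (half_form d 0))"
    using run_translate[of d w 0 "\<lambda>_. 0" "half_form d 0" 0 "int n * d m"]
    by (simp add: run run_c_power gen_def)
  have eq: "run d (w @ a_w 0) (0, \<lambda>_. 0, 0)
      = run d (replicate n (Gen_c m, True) @ a_w 0 @ w) (0, \<lambda>_. 0, 0)"
    by (rule run_word_eq[OF anti d1 conj])
  have half_eq: "half_form d ?k j = half_form d 0 j" for j
    using eq unfolding 1 2 by (auto dest: fun_cong)
  \<comment> \<open>\<open>half_form d k\<close> vanishes from \<open>k\<close> on and is \<open>d 1 = 1\<close> just before \<open>k\<close>, so it determines \<open>k\<close>.\<close>
  have k: "?k = 0"
    using half_eq[of "?k - 1"] half_eq[of "-1"] by (auto simp: half_form_def d1 split: if_splits)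
  have "a_sum w 0 (\<lambda>i. half_form d i 0) - a_sum w 0 (half_form d 0) = int n * d m"
    using eq unfolding 1 2 k by simp
  moreover have "half_form d j 0 - half_form d 0 j = d j" for j
    using anti[of j] by (cases j "0::int" rule: linorder_cases) (auto simp: half_form_def d0)
  ultimately show ?thesis
    by (simp add: a_sum_diff)
qed

text \<open>The weight bounds both the number of letters and how far from the starting position the letters
  \<open>a\<^sub>i\<close> can take effect. It is additive under concatenation, so for any finite generating set,
  whose elements may be written with arbitrary \<open>a\<^sub>i\<close> and \<open>c\<^sub>i\<close>, a group element has a word whose weight
  is at most a constant times its norm (\<open>weight_le_word_norm\<close>).\<close>

fun letter_weight :: "gen_G \<times> bool \<Rightarrow> nat" where
  "letter_weight (Gen_a i, b) = nat \<bar>i\<bar> + 1"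
| "letter_weight _ = 1"

definition weight :: "gen_G word \<Rightarrow> nat" where
  "weight w = sum_list (map letter_weight w)"

lemma abs_a_sum_le:
  assumes "\<And>j. \<bar>j\<bar> \<le> \<bar>k\<bar> + int (weight w) \<Longrightarrow> \<bar>q j\<bar> \<le> M" and "M \<ge> 0"
  shows "\<bar>a_sum w k q\<bar> \<le> int (weight w) * M"
  using assms(1)
proof (induction w k q rule: a_sum.induct)
  case (2 b w k q)
  have "\<bar>a_sum w (k + (if b then 1 else -1)) q\<bar> \<le> int (weight w) * M"
    by (rule 2(1), rule 2(2)) (auto simp: weight_def split: if_splits)
  then show ?case using \<open>M \<ge> 0\<close> by (simp add: weight_def algebra_simps)
next
  case (3 i b w k q)
  have "\<bar>a_sum w k q\<bar> \<le> int (weight w) * M"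
    by (rule 3(1), rule 3(2)) (auto simp: weight_def)
  moreover have "\<bar>q (i + k)\<bar> \<le> M"
    by (rule 3(2)) (auto simp: weight_def)
  moreover have "0 \<le> \<bar>i\<bar> * M" using \<open>M \<ge> 0\<close> by simp
  moreover have "\<bar>a_sum ((Gen_a i, b) # w) k q\<bar> \<le> \<bar>q (i + k)\<bar> + \<bar>a_sum w k q\<bar>" by auto
  moreover have "int (weight ((Gen_a i, b) # w)) * M = int (weight w) * M + M + \<bar>i\<bar> * M"
    by (simp add: weight_def algebra_simps)
  ultimately show ?case by linarith
next
  case (4 i b w k q)
  have "\<bar>a_sum w k q\<bar> \<le> int (weight w) * M"
    by (rule 4(1), rule 4(2)) (auto simp: weight_def)
  then show ?case using \<open>M \<ge> 0\<close> by (simp add: weight_def algebra_simps)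
qed (simp add: weight_def)

section \<open>Norms and conjugators in \<open>G\<^sub>d\<close>\<close>

lemma carrier_group_G: "carrier (group_G d) = range (word_class (rels_G d))"
  and one_group_G: "\<one>\<^bsub>group_G d\<^esub> = word_class (rels_G d) []"
  by (simp_all add: group_G_def presented_group_def)

lemma weight_le_word_norm:
  assumes S: "finite_generating_set (group_G d) S"
  obtains K where "\<And>h. h \<in> carrier (group_G d) \<Longrightarrow>
    \<exists>w. h = word_class (rels_G d) w \<and> weight w \<le> K * word_norm (group_G d) S h"
proof -
  interpret group "group_G d" unfolding group_G_def by (rule group_presented_group)
  let ?A = "S \<union> m_inv (group_G d) ` S"
  have "\<forall>s \<in> ?A. \<exists>v. word_class (rels_G d) v = s"
    using symmetrized_subset[OF S] unfolding carrier_group_G by blast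
  then obtain u where u: "\<And>s. s \<in> ?A \<Longrightarrow> word_class (rels_G d) (u s) = s"
    by metis
  define K where "K = Max (insert 0 ((\<lambda>s. weight (u s)) ` ?A))"
  have "finite ?A" using S by (auto simp: finite_generating_set_def)
  then have K: "weight (u s) \<le> K" if "s \<in> ?A" for s
    unfolding K_def using that by (intro Max_ge) auto
  have *: "\<exists>w. foldr (\<otimes>\<^bsub>group_G d\<^esub>) xs \<one>\<^bsub>group_G d\<^esub> = word_class (rels_G d) w
      \<and> weight w \<le> K * length xs"
    if "set xs \<subseteq> ?A" for xs
    using that
  proof (induction xs)
    case Nil
    show ?case by (intro exI[of _ "[]"]) (simp add: weight_def one_group_G)
  next
    case (Cons x xs)
    then obtain w where w: "foldr (\<otimes>\<^bsub>group_G d\<^esub>) xs \<one>\<^bsub>group_G d\<^esub> = word_class (rels_G d) w"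
      "weight w \<le> K * length xs" by auto
    have "x \<otimes>\<^bsub>group_G d\<^esub> word_class (rels_G d) w = word_class (rels_G d) (u x @ w)"
      using mult_word_class[of "rels_G d" "u x" w] u[of x] Cons.prems by (simp add: group_G_def)
    then show ?case
      using w K[of x] Cons.prems by (intro exI[of _ "u x @ w"]) (auto simp: weight_def)
  qed
  show ?thesis
  proof (rule that)
    fix h assume "h \<in> carrier (group_G d)"
    then show "\<exists>w. h = word_class (rels_G d) w \<and> weight w \<le> K * word_norm (group_G d) S h"
      using obtain_shortest_product[OF S] * by metis
  qed
qed

locale group_G_elements =
  fixes d :: "int \<Rightarrow> int"
begin

abbreviation "cls \<equiv> word_class (rels_G d)"
abbreviation "T \<equiv> cls t_w"
abbreviation "A i \<equiv> cls (a_w i)"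
abbreviation "C i \<equiv> cls (c_w i)"

sublocale group "group_G d"
  unfolding group_G_def by (rule group_presented_group)

lemma cls_closed [simp]: "cls w \<in> carrier (group_G d)"
  by (simp add: carrier_group_G)

lemma mult_cls: "cls u \<otimes>\<^bsub>group_G d\<^esub> cls v = cls (u @ v)"
  by (simp add: group_G_def mult_word_class)

lemma inv_cls: "inv\<^bsub>group_G d\<^esub> cls u = cls (inv_word u)"
  by (simp add: group_G_def inv_word_class)

lemma cls_rel: "(u, v) \<in> rels_G d \<Longrightarrow> cls u = cls v"
  by (simp add: word_class_eq_iff word_eq.rel)

lemma conj_eq_imp:
  assumes "x \<in> carrier (group_G d)" "y \<in> carrier (group_G d)" "z \<in> carrier (group_G d)"
    "x \<otimes>\<^bsub>group_G d\<^esub> (y \<otimes>\<^bsub>group_G d\<^esub> inv\<^bsub>group_G d\<^esub> x) = z"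
  shows "x \<otimes>\<^bsub>group_G d\<^esub> y = z \<otimes>\<^bsub>group_G d\<^esub> x"
  using assms by (metis inv_closed inv_solve_right' m_assoc m_closed)

lemma comm_eq_imp:
  assumes "cls (comm_word u v) = z"
  shows "cls u \<otimes>\<^bsub>group_G d\<^esub> cls v = z \<otimes>\<^bsub>group_G d\<^esub> cls v \<otimes>\<^bsub>group_G d\<^esub> cls u"
proof -
  have "z = cls u \<otimes>\<^bsub>group_G d\<^esub> cls v \<otimes>\<^bsub>group_G d\<^esub> inv\<^bsub>group_G d\<^esub> cls u
      \<otimes>\<^bsub>group_G d\<^esub> inv\<^bsub>group_G d\<^esub> cls v"
    using assms by (simp add: comm_word_def mult_cls inv_cls)
  then show ?thesis by (simp add: m_assoc)
qed

lemma T_A: "T \<otimes>\<^bsub>group_G d\<^esub> A i = A (i + 1) \<otimes>\<^bsub>group_G d\<^esub> T"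
  using cls_rel[OF rels_G.intros(1)[of i d]]
  by (intro conj_eq_imp) (simp_all add: mult_cls inv_cls)

lemma A_A: "A i \<otimes>\<^bsub>group_G d\<^esub> A j = C (i - j) \<otimes>\<^bsub>group_G d\<^esub> A j \<otimes>\<^bsub>group_G d\<^esub> A i"
  by (rule comm_eq_imp[OF cls_rel[OF rels_G.intros(3)]])

lemma C_A: "C i \<otimes>\<^bsub>group_G d\<^esub> A j = A j \<otimes>\<^bsub>group_G d\<^esub> C i"
  using comm_eq_imp[OF cls_rel[OF rels_G.intros(4)[of i j]]]
  by (simp add: mult_cls)

text \<open>The source of cheap elements: all \<open>n\<close> letters of \<open>a\<^sub>i\<^sup>n\<close> share one trip of length \<open>i\<close>.\<close>

lemma T_pow_A_pow:
  "T [^]\<^bsub>group_G d\<^esub> (i::nat) \<otimes>\<^bsub>group_G d\<^esub> A 0 [^]\<^bsub>group_G d\<^esub> (n::nat)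
     = A (int i) [^]\<^bsub>group_G d\<^esub> n \<otimes>\<^bsub>group_G d\<^esub> T [^]\<^bsub>group_G d\<^esub> i"
proof -
  have 1: "T [^]\<^bsub>group_G d\<^esub> i \<otimes>\<^bsub>group_G d\<^esub> A 0 = A (int i) \<otimes>\<^bsub>group_G d\<^esub> T [^]\<^bsub>group_G d\<^esub> i"
  proof (induction i)
    case (Suc i)
    have "T [^]\<^bsub>group_G d\<^esub> Suc i \<otimes>\<^bsub>group_G d\<^esub> A 0
        = T \<otimes>\<^bsub>group_G d\<^esub> (T [^]\<^bsub>group_G d\<^esub> i \<otimes>\<^bsub>group_G d\<^esub> A 0)"
      unfolding nat_pow_Suc2[OF cls_closed] by (simp add: m_assoc)
    also have "\<dots> = (T \<otimes>\<^bsub>group_G d\<^esub> A (int i)) \<otimes>\<^bsub>group_G d\<^esub> T [^]\<^bsub>group_G d\<^esub> i"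
      by (simp add: Suc m_assoc)
    also have "\<dots> = A (int (Suc i)) \<otimes>\<^bsub>group_G d\<^esub> T [^]\<^bsub>group_G d\<^esub> Suc i"
      unfolding nat_pow_Suc2[OF cls_closed] T_A by (simp add: m_assoc add.commute)
    finally show ?case .
  qed simp
  show ?thesis
  proof (induction n)
    case (Suc n)
    then show ?case using 1
      by (metis cls_closed m_assoc nat_pow_Suc nat_pow_closed)
  qed simp
qed

lemma C_pow_commutator:
  "C (int m) [^]\<^bsub>group_G d\<^esub> (i * j) =
    A (int m) [^]\<^bsub>group_G d\<^esub> (i::nat) \<otimes>\<^bsub>group_G d\<^esub> A 0 [^]\<^bsub>group_G d\<^esub> (j::nat)
    \<otimes>\<^bsub>group_G d\<^esub> inv\<^bsub>group_G d\<^esub> (A (int m) [^]\<^bsub>group_G d\<^esub> i)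
    \<otimes>\<^bsub>group_G d\<^esub> inv\<^bsub>group_G d\<^esub> (A 0 [^]\<^bsub>group_G d\<^esub> j)"
  using pow_mult_pow_commutator[of "A (int m)" "A 0" "C (int m)" i j] A_A[of "int m" 0] C_A
  by (simp add: m_assoc)

lemma word_norm_C_pow:
  assumes S: "finite_generating_set (group_G d) S"
  obtains K where "\<And>m n. word_norm (group_G d) S (C (int m) [^]\<^bsub>group_G d\<^esub> (n * n)) \<le> K * (m + n)"
proof -
  let ?N = "word_norm (group_G d) S"
  define K where "K = ?N T + ?N (inv\<^bsub>group_G d\<^esub> T) + ?N (A 0) + ?N (inv\<^bsub>group_G d\<^esub> A 0)"
  note mult = word_norm_mult_le[OF S]
  have pow: "?N (x [^]\<^bsub>group_G d\<^esub> n) \<le> K * n"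
    if "x \<in> {T, inv\<^bsub>group_G d\<^esub> T, A 0, inv\<^bsub>group_G d\<^esub> A 0}" for x and n :: nat
  proof -
    have "?N (x [^]\<^bsub>group_G d\<^esub> n) \<le> n * ?N x"
      using that by (intro word_norm_pow_le[OF S]) auto
    also have "\<dots> \<le> n * K"
      using that by (intro mult_left_mono) (auto simp: K_def)
    finally show ?thesis by (simp add: mult.commute)
  qed
  have A: "?N (A (int m) [^]\<^bsub>group_G d\<^esub> n) \<le> K * (2 * m + n)" for m n
  proof -
    let ?t = "T [^]\<^bsub>group_G d\<^esub> m" and ?a = "A 0 [^]\<^bsub>group_G d\<^esub> n"
    have "A (int m) [^]\<^bsub>group_G d\<^esub> n = ?t \<otimes>\<^bsub>group_G d\<^esub> ?a \<otimes>\<^bsub>group_G d\<^esub> inv\<^bsub>group_G d\<^esub> T [^]\<^bsub>group_G d\<^esub> m"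
      unfolding T_pow_A_pow by (simp add: nat_pow_inv m_assoc)
    also have "?N \<dots> \<le> K * m + K * n + K * m"
      using mult[of "?t \<otimes>\<^bsub>group_G d\<^esub> ?a" "inv\<^bsub>group_G d\<^esub> T [^]\<^bsub>group_G d\<^esub> m"] mult[of ?t ?a]
        pow[of T m] pow[of "A 0" n] pow[of "inv\<^bsub>group_G d\<^esub> T" m]
      by simp
    finally show ?thesis by (simp add: algebra_simps)
  qed
  have A': "?N (inv\<^bsub>group_G d\<^esub> (A (int m) [^]\<^bsub>group_G d\<^esub> n)) \<le> K * (2 * m + n)" for m n
  proof -
    let ?t = "T [^]\<^bsub>group_G d\<^esub> m" and ?a = "inv\<^bsub>group_G d\<^esub> A 0 [^]\<^bsub>group_G d\<^esub> n"
    have "A (int m) [^]\<^bsub>group_G d\<^esub> n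
        = ?t \<otimes>\<^bsub>group_G d\<^esub> A 0 [^]\<^bsub>group_G d\<^esub> n \<otimes>\<^bsub>group_G d\<^esub> inv\<^bsub>group_G d\<^esub> ?t"
      unfolding T_pow_A_pow by (simp add: m_assoc)
    then have "inv\<^bsub>group_G d\<^esub> (A (int m) [^]\<^bsub>group_G d\<^esub> n)
        = ?t \<otimes>\<^bsub>group_G d\<^esub> ?a \<otimes>\<^bsub>group_G d\<^esub> inv\<^bsub>group_G d\<^esub> T [^]\<^bsub>group_G d\<^esub> m"
      by (simp add: nat_pow_inv inv_mult_group m_assoc)
    also have "?N \<dots> \<le> K * m + K * n + K * m"
      using mult[of "?t \<otimes>\<^bsub>group_G d\<^esub> ?a" "inv\<^bsub>group_G d\<^esub> T [^]\<^bsub>group_G d\<^esub> m"] mult[of ?t ?a]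
        pow[of T m] pow[of "inv\<^bsub>group_G d\<^esub> A 0" n] pow[of "inv\<^bsub>group_G d\<^esub> T" m]
      by simp
    finally show ?thesis by (simp add: algebra_simps)
  qed
  have "?N (C (int m) [^]\<^bsub>group_G d\<^esub> (n * n)) \<le> (4 * K) * (m + n)" for m n
  proof -
    let ?x = "A (int m) [^]\<^bsub>group_G d\<^esub> n" and ?y = "A 0 [^]\<^bsub>group_G d\<^esub> n"
    have "?N (C (int m) [^]\<^bsub>group_G d\<^esub> (n * n))
        \<le> K * (2 * m + n) + K * n + K * (2 * m + n) + K * n"
      unfolding C_pow_commutator
      using mult[of "?x \<otimes>\<^bsub>group_G d\<^esub> ?y \<otimes>\<^bsub>group_G d\<^esub> inv\<^bsub>group_G d\<^esub> ?x" "inv\<^bsub>group_G d\<^esub> ?y"]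
        mult[of "?x \<otimes>\<^bsub>group_G d\<^esub> ?y" "inv\<^bsub>group_G d\<^esub> ?x"] mult[of ?x ?y]
        A[of m n] A'[of m n] pow[of "A 0" n] pow[of "inv\<^bsub>group_G d\<^esub> A 0" n]
      by (simp add: nat_pow_inv)
    then show ?thesis by (simp add: algebra_simps)
  qed
  then show ?thesis by (rule that)
qed

lemma A_conjugate_C_pow_A: "conjugate (group_G d) (A 0) (C (int m) [^]\<^bsub>group_G d\<^esub> (n::nat) \<otimes>\<^bsub>group_G d\<^esub> A 0)"
proof -
  have "A (int m) [^]\<^bsub>group_G d\<^esub> n \<otimes>\<^bsub>group_G d\<^esub> A 0
      = C (int m) [^]\<^bsub>group_G d\<^esub> n \<otimes>\<^bsub>group_G d\<^esub> A 0 \<otimes>\<^bsub>group_G d\<^esub> A (int m) [^]\<^bsub>group_G d\<^esub> n"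
    using A_A[of "int m" 0] C_A by (intro pow_mult_commutator_left) simp_all
  then have "A (int m) [^]\<^bsub>group_G d\<^esub> n \<in> conjugators (group_G d) (A 0)
      (C (int m) [^]\<^bsub>group_G d\<^esub> n \<otimes>\<^bsub>group_G d\<^esub> A 0)"
    by (simp add: conjugators_def m_assoc)
  then show ?thesis by (auto simp: conjugate_def)
qed

lemma C_pow: "C i [^]\<^bsub>group_G d\<^esub> n = cls (replicate n (Gen_c i, True))"
proof (induction n)
  case (Suc n)
  then show ?case
    by (simp add: mult_cls gen_def flip: replicate_append_same)
qed (simp add: one_group_G)

lemma conjugator_a_sum:
  assumes anti: "\<And>i. d (- i) = - d i" and d1: "d 1 = 1"
    and "cls w \<in> conjugators (group_G d) (A 0) (C m [^]\<^bsub>group_G d\<^esub> n \<otimes>\<^bsub>group_G d\<^esub> A 0)"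
  shows "a_sum w 0 d = int n * d m"
proof (rule conjugator_word_a_sum[OF anti d1])
  have "cls w \<otimes>\<^bsub>group_G d\<^esub> A 0 \<otimes>\<^bsub>group_G d\<^esub> inv\<^bsub>group_G d\<^esub> cls w = C m [^]\<^bsub>group_G d\<^esub> n \<otimes>\<^bsub>group_G d\<^esub> A 0"
    using assms(3) by (simp add: conjugators_def)
  then have "cls w \<otimes>\<^bsub>group_G d\<^esub> A 0 = C m [^]\<^bsub>group_G d\<^esub> n \<otimes>\<^bsub>group_G d\<^esub> A 0 \<otimes>\<^bsub>group_G d\<^esub> cls w"
    by (intro conj_eq_imp) (simp_all add: m_assoc)
  then have "cls (w @ a_w 0) = cls (replicate n (Gen_c m, True) @ a_w 0 @ w)"
    by (simp add: mult_cls C_pow)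
  then show "word_eq (rels_G d) (w @ a_w 0) (replicate n (Gen_c m, True) @ a_w 0 @ w)"
    by (simp add: word_class_eq_iff)
qed

end

section \<open>Growth of the sequence and of \<open>d\<close>\<close>

text \<open>Doubling leaves room for the rounding; it holds because \<open>m\<^sub>i \<ge> 6\<close> gives \<open>\<surd>m\<^sub>i \<ge> 2\<close>.\<close>

lemma m_seq_Suc_less: "m_seq i < m_seq (Suc i)"
proof -
  have "real (m_seq i) * 2 \<le> real (m_seq i) * sqrt (real (m_seq i))"
    using m_seq_ge[of i] by (intro mult_left_mono real_le_rsqrt) auto
  also have "\<dots> = real (m_seq i) powr (3 / 2)"
    using powr_add[of "real (m_seq i)" 1 "1/2"] m_seq_ge[of i] by (simp add: powr_half_sqrt)
  finally have "int (m_seq i) * 2 \<le> \<lfloor>real (m_seq i) powr (3 / 2)\<rfloor>"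
    by (simp add: le_floor_iff)
  then show ?thesis using m_seq_ge[of i] by simp
qed

lemma strict_mono_m_seq: "strict_mono m_seq"
  by (simp add: strict_mono_Suc_iff m_seq_Suc_less del: m_seq.simps)

lemma m_seq_Suc_le: "real (m_seq (Suc i)) \<le> real (m_seq i) powr (3 / 2)"
  by simp

lemma m_seq_Suc_ge: "real (m_seq i) powr (3 / 2) \<le> 2 * real (m_seq (Suc i))"
proof -
  have "real (m_seq i) powr (3 / 2) < real (m_seq (Suc i)) + 1"
    by simp
  then show ?thesis using m_seq_ge[of "Suc i"] by linarith
qed

lemma obtain_m_seq_bracket:
  assumes "6 \<le> n"
  obtains i where "m_seq i \<le> n" "n < m_seq (Suc i)"
proof -
  let ?j = "LEAST j. n < m_seq j"
  have ex: "\<exists>j. n < m_seq j"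
    using seq_suble[OF strict_mono_m_seq, of "Suc n"] by (intro exI[of _ "Suc n"]) simp
  have j: "n < m_seq ?j" by (rule LeastI_ex[OF ex])
  then obtain i where i: "?j = Suc i"
    using assms by (cases ?j) auto
  have "\<not> n < m_seq i" using i by (intro not_less_Least) simp
  then show ?thesis using that[of i] j i by simp
qed

lemma abs_d_fun_le:
  assumes "\<bar>j\<bar> < int (m_seq (Suc i))"
  shows "\<bar>d_fun j\<bar> \<le> int (m_seq i)"
proof (cases "\<exists>l. \<bar>j\<bar> = int (m_seq l)")
  case True
  then obtain l where l: "\<bar>j\<bar> = int (m_seq l)" by blast
  then have "l < Suc i"
    using assms strict_mono_less[OF strict_mono_m_seq, of l "Suc i"] by (simp del: m_seq.simps)
  then have "m_seq l \<le> m_seq i"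
    using strict_mono_less_eq[OF strict_mono_m_seq] by simp
  then show ?thesis using l True by (simp add: d_fun_def)
next
  case False
  then have "\<bar>d_fun j\<bar> \<le> 1" by (auto simp: d_fun_def abs_sgn_eq)
  then show ?thesis using m_seq_ge[of i] by linarith
qed

section \<open>The lower bound\<close>

text \<open>A word either reaches position \<open>m\<^bsub>i+2\<^esub>\<close>, and then pays for the distance, or it sees only values
  \<open>\<bar>d\<bar> \<le> m\<^bsub>i+1\<^esub>\<close>, and then pays in letters. The factor 2 absorbs the rounding in \<open>m\<^bsub>i+2\<^esub>\<close>.\<close>

lemma weight_lower_bound:
  assumes sum: "a_sum w 0 d_fun = int (n * n) * int (m_seq i)"
    and lo: "m_seq i \<le> n" and hi: "n < m_seq (Suc i)"
  shows "real n powr (3 / 2) \<le> 2 * real (weight w)"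
proof (cases "weight w < m_seq (Suc (Suc i))")
  case False
  have "real n powr (3 / 2) \<le> real (m_seq (Suc i)) powr (3 / 2)"
    using hi by (intro powr_mono2) auto
  also have "\<dots> \<le> 2 * real (m_seq (Suc (Suc i)))" by (rule m_seq_Suc_ge)
  also have "\<dots> \<le> 2 * real (weight w)" using False by simp
  finally show ?thesis .
next
  case True
  let ?m = "real (m_seq i)"
  have m: "?m > 0" using m_seq_ge[of i] by simp
  have n: "real n > 0" using m lo by simp
  have "\<bar>a_sum w 0 d_fun\<bar> \<le> int (weight w) * int (m_seq (Suc i))"
    using True by (intro abs_a_sum_le abs_d_fun_le) auto
  then have "int (n * n * m_seq i) \<le> int (weight w * m_seq (Suc i))"
    using sum by simp
  then have "real (n * n * m_seq i) \<le> real (weight w * m_seq (Suc i))"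
    by (simp only: of_nat_le_iff)
  also have "\<dots> \<le> real (weight w) * ?m powr (3 / 2)"
    using m_seq_Suc_le[of i] by (simp add: mult_left_mono del: m_seq.simps)
  also have "?m powr (3 / 2) = ?m * ?m powr (1 / 2)"
    using powr_add[of ?m 1 "1 / 2"] m by simp
  finally have "real n * real n \<le> real (weight w) * ?m powr (1 / 2)"
    using m by (simp add: mult_ac)
  also have "\<dots> \<le> real (weight w) * real n powr (1 / 2)"
    using lo by (intro mult_left_mono powr_mono2) auto
  also have "real n * real n = real n powr (3 / 2) * real n powr (1 / 2)"
    using n by (simp add: power2_eq_square flip: powr_add)
  finally show ?thesis using n by simp
qed

theorem proposition4p42:
  fixes S :: "gen_G word set set"
  assumes "finite_generating_set (group_G d_fun) S"
  shows "dominated (\<lambda>n. real n powr (4 / 3))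
           (\<lambda>n. real (conjugator_length (group_G d_fun) S n))"
proof -
  interpret group_G_elements d_fun .
  let ?G = "group_G d_fun"
  let ?N = "word_norm ?G S"
  obtain K where K: "\<And>h. h \<in> carrier ?G \<Longrightarrow> \<exists>w. h = cls w \<and> weight w \<le> K * ?N h"
    using weight_le_word_norm[OF assms] by blast
  obtain K' where K': "\<And>m n. ?N (C (int m) [^]\<^bsub>?G\<^esub> (n * n)) \<le> K' * (m + n)"
    using word_norm_C_pow[OF assms] by blast
  \<comment> \<open>The first two summands make both elements of the pair short enough, with \<open>12 n\<close> bounding
    \<open>m\<^sub>i + r\<close> below; the third passes from weights back to norms.\<close>
  define D where "D = 12 * K' + ?N (A 0) + 2 * K + 1"
  have "real n powr (4 / 3) \<le> real D * real (conjugator_length ?G S (D * n))" if n: "n \<ge> 1" for n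
  proof -
    \<comment> \<open>The sequence starts at 6, so small \<open>n\<close> are raised to 6, at the cost of a constant factor.\<close>
    define r where "r = max 6 n"
    have r: "6 \<le> r" "n \<le> r" "r \<le> 6 * n" using n by (auto simp: r_def)
    obtain i where lo: "m_seq i \<le> r" and hi: "r < m_seq (Suc i)"
      using obtain_m_seq_bracket r(1) by blast
    let ?m = "m_seq i"
    let ?g = "C (int ?m) [^]\<^bsub>?G\<^esub> (r * r) \<otimes>\<^bsub>?G\<^esub> A 0"
    have conj: "conjugate ?G (A 0) ?g" by (rule A_conjugate_C_pow_A)
    have "?N ?g \<le> K' * (?m + r) + ?N (A 0)"
      using word_norm_mult_le[OF assms, of "C (int ?m) [^]\<^bsub>?G\<^esub> (r * r)" "A 0"] K'[of ?m r] by simp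
    also have "\<dots> \<le> K' * (12 * n) + ?N (A 0) * n"
      using lo r n by (intro add_mono mult_left_mono) auto
    also have "\<dots> \<le> D * n" by (simp add: D_def algebra_simps)
    finally have g: "?N ?g \<le> D * n" .
    have "?N (A 0) * 1 \<le> D * n" using n by (intro mult_mono) (auto simp: D_def)
    then have L: "conjugator_norm ?G S (A 0) ?g \<le> conjugator_length ?G S (D * n)"
      using g by (intro conjugator_norm_le_conjugator_length[OF assms] conj) auto
    obtain h where h: "h \<in> conjugators ?G (A 0) ?g" "?N h = conjugator_norm ?G S (A 0) ?g"
      using obtain_shortest_conjugator[OF conj] by metis
    then have "h \<in> carrier ?G" by (simp add: conjugators_def)
    then obtain w where w: "h = cls w" "weight w \<le> K * ?N h" using K by blast
    have "a_sum w 0 d_fun = int (r * r) * d_fun (int ?m)"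
      using h(1) unfolding w(1) by (rule conjugator_a_sum[OF d_fun_minus d_fun_1])
    also have "d_fun (int ?m) = int ?m" by (auto simp: d_fun_def)
    finally have "real r powr (3 / 2) \<le> 2 * real (weight w)"
      using lo hi by (rule weight_lower_bound)
    moreover have "real n powr (4 / 3) \<le> real r powr (4 / 3)"
      using r by (intro powr_mono2) auto
    moreover have "real r powr (4 / 3) \<le> real r powr (3 / 2)"
      using r by (intro powr_mono) auto
    ultimately have "real n powr (4 / 3) \<le> real (2 * weight w)" by simp
    also have "2 * weight w \<le> D * conjugator_length ?G S (D * n)"
    proof -
      have "2 * weight w \<le> (2 * K) * conjugator_length ?G S (D * n)"
        using w(2) h(2) order.trans[OF w(2) mult_left_mono[of _ _ K]] L by simp
      also have "\<dots> \<le> D * conjugator_length ?G S (D * n)"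
        by (intro mult_right_mono) (auto simp: D_def)
      finally show ?thesis .
    qed
    finally show ?thesis by simp
  qed
  moreover have "D \<ge> 1" by (simp add: D_def)
  ultimately show ?thesis unfolding dominated_def by blast
qed

end
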